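(* Suppose each $f_i$ is $L_i$-smooth and $\mu_i$-strongly convex with $\mu_i>0$. Let $\{\alpha_i^k\}_{k\ge1}$ be generated by AdGT with the local-gradient stepsize update $$\alpha_i^{k+1}=\min\Big\{\tfrac{1}{2\gamma L_{f_i}^k},\ \sqrt{1+\theta_i^k}\,\alpha_i^k\Big\}\qquad(i\in\mathcal V,\ k\ge 0).$$ Assume that $L_{f_i}^0$ is well defined for every agent $i$ (i.e. $\bm x_i^1\ne\bm x_i^0$), and that the initial stepsize satisfies $\alpha_i^0\ge\frac{1}{2\gamma L_i}$. Then, with $L=\max_iL_i$ and $\mu=\min_i\mu_i$, for every $i\in\mathcal V$ and all $k\ge1$, $$\frac{1}{2\gamma L}\le\alpha_i^k\le\frac{1}{2\gamma\mu}.$$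
   Context: Problem. Let $\mathcal G=(\mathcal V,\mathcal E)$, $\mathcal V=\{1,\dots,n\}$, be an undirected connected graph, and let $\mathcal N_i=\{j:(j,i)\in\mathcal E\}\cup\{i\}$. $W=[w_{ij}]\in\mathbb R^{n\times n}$ is a symmetric doubly stochastic matrix with $w_{ij}>0$ if $j\in\mathcal N_i$ and $w_{ij}=0$ otherwise. Each agent $i$ has a function $f_i:\mathbb R^p\to\mathbb R$. The function $f_i$ is $L_i$-smooth if it is differentiable with $\|\nabla f_i(\bm x)-\nabla f_i(\bm x')\|\le L_i\|\bm x-\bm x'\|$ for all $\bm x,\bm x'$; it is $\mu_i$-strongly convex if $f_i(\bm y)\ge f_i(\bm x)+\nabla f_i(\bm x)^\top(\bm y-\bm x)+\frac{\mu_i}{2}\|\bm y-\bm x\|^2$ for all $\bm x,\bm y$. $\|\cdot\|$ is the Euclidean norm. Algorithm AdGT. Given $\gamma>0$ (a common safety factor), $\bm x_i^0\in\mathbb R^p$, $\bm y_i^0=\nabla f_i(\bm x_i^0)$, $\alpha_i^0>0$, $\theta_i^0=0$, for $k=0,1,\dots$ every agent $i$ computes $$\bm x_i^{k+1}=\sum_{j\in\mathcal N_i}w_{ij}(\bm x_j^k-\alpha_j^k\bm y_j^k),\qquad \bm y_i^{k+1}=\sum_{j\in\mathcal N_i}w_{ij}\bm y_j^k+\nabla f_i(\bm x_i^{k+1})-\nabla f_i(\bm x_i^k),$$ then $\alpha_i^{k+1}$ by the stated stepsize update, and $\theta_i^{k+1}=\alpha_i^{k+1}/\alpha_i^k$.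 Here $$L_{f_i}^k=\frac{\|\nabla f_i(\bm x_i^{k+1})-\nabla f_i(\bm x_i^k)\|}{\|\bm x_i^{k+1}-\bm x_i^k\|}.$$ Convention: if $\bm x_i^{k+1}=\bm x_i^k$ for some $k\ge1$, set $\alpha_i^{k+1}=\alpha_i^k$. *)

theory Defs
  imports "HOL-Analysis.Analysis"
begin

text \<open>Graph and mixing matrix. The vertices are all elements of a finite type, and an undirected
  edge is represented by both of its orientations. Self-loops are neither required nor excluded;
  they do not affect \<open>nbhd\<close>.\<close>

definition undirected_connected :: "('n \<times> 'n) set \<Rightarrow> bool" where
  "undirected_connected E \<longleftrightarrow> sym E \<and> (\<forall>u v. (u, v) \<in> E\<^sup>*)"

definition nbhd :: "('n \<times> 'n) set \<Rightarrow> 'n \<Rightarrow> 'n set" where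
  "nbhd E i = {j. (j, i) \<in> E} \<union> {i}"

definition doubly_stochastic :: "real ^ 'n ^ 'n \<Rightarrow> bool" where
  "doubly_stochastic W \<longleftrightarrow>
     (\<forall>i j. W $ i $ j \<ge> 0) \<and> (\<forall>i. (\<Sum>j\<in>UNIV. W $ i $ j) = 1) \<and> (\<forall>j. (\<Sum>i\<in>UNIV. W $ i $ j) = 1)"

definition mixing_matrix :: "('n \<times> 'n) set \<Rightarrow> real ^ 'n ^ 'n \<Rightarrow> bool" where
  "mixing_matrix E W \<longleftrightarrow>
     transpose W = W \<and> doubly_stochastic W \<and>
     (\<forall>i j. (j \<in> nbhd E i \<longrightarrow> W $ i $ j > 0) \<and> (j \<notin> nbhd E i \<longrightarrow> W $ i $ j = 0))"

definition gradient :: "('a::real_inner \<Rightarrow> real) \<Rightarrow> 'a \<Rightarrow> 'a" where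
  "gradient f x = (THE D. GDERIV f x :> D)"

lemma gradient_eqI:
  assumes "GDERIV f x :> D"
  shows "gradient f x = D"
  unfolding gradient_def
proof (rule the_equality)
  show "GDERIV f x :> D" by fact
next
  fix D' assume "GDERIV f x :> D'"
  then have "(\<lambda>h. h \<bullet> D') = (\<lambda>h. h \<bullet> D)"
    using assms has_derivative_unique unfolding gderiv_def by blast
  then have "(D' - D) \<bullet> D' = (D' - D) \<bullet> D" by metis
  then have "(D' - D) \<bullet> (D' - D) = 0" by (simp add: inner_diff_right)
  then show "D' = D" by simp
qed

lemma GDERIV_gradient:
  fixes f :: "'a::euclidean_space \<Rightarrow> real"
  assumes "f differentiable at x"
  shows "GDERIV f x :> gradient f x"
proof -
  obtain f' where f': "(f has_derivative f') (at x)"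
    using assms unfolding differentiable_def by blast
  interpret linear f' using f' has_derivative_linear by blast
  have "f' h = h \<bullet> (\<Sum>b\<in>Basis. f' b *\<^sub>R b)" for h
  proof -
    have "f' h = f' (\<Sum>b\<in>Basis. (h \<bullet> b) *\<^sub>R b)" by (simp only: euclidean_representation)
    also have "\<dots> = h \<bullet> (\<Sum>b\<in>Basis. f' b *\<^sub>R b)"
      by (simp add: sum scale inner_sum_right mult.commute)
    finally show ?thesis .
  qed
  then have "f' = (\<lambda>h. h \<bullet> (\<Sum>b\<in>Basis. f' b *\<^sub>R b))" by blast
  then have "GDERIV f x :> (\<Sum>b\<in>Basis. f' b *\<^sub>R b)"
    unfolding gderiv_def using f' by simp
  then show ?thesis using gradient_eqI by metis
qed

definition smooth_with :: "real \<Rightarrow> ('a::real_inner \<Rightarrow> real) \<Rightarrow> bool" where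
  "smooth_with L f \<longleftrightarrow>
     (\<forall>x. f differentiable at x) \<and>
     (\<forall>x x'. norm (gradient f x - gradient f x') \<le> L * norm (x - x'))"

definition strongly_convex_with :: "real \<Rightarrow> ('a::real_inner \<Rightarrow> real) \<Rightarrow> bool" where
  "strongly_convex_with \<mu> f \<longleftrightarrow>
     (\<forall>x y. f y \<ge> f x + gradient f x \<bullet> (y - x) + \<mu> / 2 * (norm (y - x))\<^sup>2)"

text \<open>Sequences of the algorithm are indexed as \<open>x k i\<close>: iteration \<open>k\<close>, agent \<open>i\<close>.
  The relation \<open>AdGT\<close> leaves the stepsizes \<open>\<alpha> (Suc k) i\<close> to a separate stepsize update.\<close>

definition AdGT ::
  "('n \<times> 'n) set \<Rightarrow> real ^ 'n ^ 'n \<Rightarrow> ('n \<Rightarrow> real ^ 'p \<Rightarrow> real) \<Rightarrow>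
   (nat \<Rightarrow> 'n \<Rightarrow> real ^ 'p) \<Rightarrow> (nat \<Rightarrow> 'n \<Rightarrow> real ^ 'p) \<Rightarrow>
   (nat \<Rightarrow> 'n \<Rightarrow> real) \<Rightarrow> (nat \<Rightarrow> 'n \<Rightarrow> real) \<Rightarrow> bool" where
  "AdGT E W f x y \<alpha> \<theta> \<longleftrightarrow>
     (\<forall>i. y 0 i = gradient (f i) (x 0 i) \<and> \<alpha> 0 i > 0 \<and> \<theta> 0 i = 0) \<and>
     (\<forall>k i. x (Suc k) i = (\<Sum>j\<in>nbhd E i. (W $ i $ j) *\<^sub>R (x k j - \<alpha> k j *\<^sub>R y k j))) \<and>
     (\<forall>k i. y (Suc k) i = (\<Sum>j\<in>nbhd E i. (W $ i $ j) *\<^sub>R y k j)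
                          + gradient (f i) (x (Suc k) i) - gradient (f i) (x k i)) \<and>
     (\<forall>k i. \<theta> (Suc k) i = \<alpha> (Suc k) i / \<alpha> k i)"

definition local_L ::
  "('n \<Rightarrow> 'a::real_inner \<Rightarrow> real) \<Rightarrow> (nat \<Rightarrow> 'n \<Rightarrow> 'a) \<Rightarrow> nat \<Rightarrow> 'n \<Rightarrow> real" where
  "local_L f x k i =
     norm (gradient (f i) (x (Suc k) i) - gradient (f i) (x k i)) / norm (x (Suc k) i - x k i)"

text \<open>The quotient \<open>local_L f x k i\<close> is only used when the two iterates differ. If they coincide,
  the stepsize is kept for \<open>k \<ge> 1\<close>, while \<open>\<alpha> 1 i\<close> is left unspecified for \<open>k = 0\<close>.\<close>

definition local_gradient_stepsize ::
  "real \<Rightarrow> ('n \<Rightarrow> 'a::real_inner \<Rightarrow> real) \<Rightarrow> (nat \<Rightarrow> 'n \<Rightarrow> 'a) \<Rightarrow>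
   (nat \<Rightarrow> 'n \<Rightarrow> real) \<Rightarrow> (nat \<Rightarrow> 'n \<Rightarrow> real) \<Rightarrow> bool" where
  "local_gradient_stepsize \<gamma> f x \<alpha> \<theta> \<longleftrightarrow>
     (\<forall>k i.
        (x (Suc k) i \<noteq> x k i \<longrightarrow>
           \<alpha> (Suc k) i = min (1 / (2 * \<gamma> * local_L f x k i)) (sqrt (1 + \<theta> k i) * \<alpha> k i)) \<and>
        (k \<ge> 1 \<and> x (Suc k) i = x k i \<longrightarrow> \<alpha> (Suc k) i = \<alpha> k i))"

end

theory Submission
  imports Defs
begin

text \<open>
  The stepsize bounds are purely local: they come from the points at which a single agent
  samples its own gradient.

  Smoothness and strong convexity squeeze every difference quotient of the gradient of \<open>f i\<close>
  between \<open>\<mu> i\<close> and \<open>L i\<close> (\<open>local_L_ge\<close>, \<open>local_L_le\<close>), so \<open>1 / (2 * \<gamma> * local_L f x k i)\<close> always lies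
  between the values \<open>1 / (2 * \<gamma> * L i)\<close> and \<open>1 / (2 * \<gamma> * \<mu> i)\<close>. For the upper bound the
  minimum is at most its first argument, which forces the bound from the first update on. For the
  lower bound the second argument of the minimum is at least the previous stepsize, because
  \<open>\<theta> k i\<close> is zero or a ratio of positive stepsizes and so \<open>sqrt (1 + \<theta> k i) \<ge> 1\<close>; the lower
  bound is therefore inherited inductively from \<open>\<alpha> 0 i\<close>. The bounds common to all agents follow
  by taking the worst constants.
\<close>

text \<open>Adding the strong convexity inequalities for \<open>(a, b)\<close> and \<open>(b, a)\<close> cancels the function
  values and leaves strong monotonicity of the gradient; Cauchy-Schwarz then gives the bound.\<close>

lemma strongly_convex_gradient_expansion:
  assumes "strongly_convex_with \<mu> f"
  shows "\<mu> * norm (b - a) \<le> norm (gradient f b - gradient f a)"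
proof (cases "b = a")
  case False
  let ?g = "gradient f b - gradient f a"
  have "f b \<ge> f a + gradient f a \<bullet> (b - a) + \<mu> / 2 * (norm (b - a))\<^sup>2"
    and "f a \<ge> f b + gradient f b \<bullet> (a - b) + \<mu> / 2 * (norm (a - b))\<^sup>2"
    using assms unfolding strongly_convex_with_def by blast+
  then have "\<mu> * (norm (b - a))\<^sup>2 \<le> ?g \<bullet> (b - a)"
    by (simp add: norm_minus_commute inner_diff_left inner_diff_right)
  also have "\<dots> \<le> norm ?g * norm (b - a)"
    by (rule norm_cauchy_schwarz)
  finally show ?thesis
    using False by (simp add: power2_eq_square mult.assoc[symmetric])
qed simp

lemma local_L_ge:
  assumes "strongly_convex_with \<mu> (f i)" and "x (Suc k) i \<noteq> x k i"
  shows "\<mu> \<le> local_L f x k i"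
  unfolding local_L_def
  using assms strongly_convex_gradient_expansion[OF assms(1), of "x (Suc k) i" "x k i"]
  by (simp add: pos_le_divide_eq)

lemma local_L_le:
  assumes "smooth_with L (f i)" and "x (Suc k) i \<noteq> x k i"
  shows "local_L f x k i \<le> L"
  using assms unfolding local_L_def smooth_with_def by (simp add: pos_divide_le_eq)

text \<open>Nonnegativity of \<open>\<theta>\<close> has to be carried through the induction together with the bound: it
  makes the growth factor at least one, and in turn it depends on positivity of two
  consecutive stepsizes.\<close>

lemma stepsize_lower_bound:
  assumes "smooth_with L (f i)" and "strongly_convex_with \<mu> (f i)" and "\<mu> > 0"
    and "\<gamma> > 0" and "L > 0"
    and step: "local_gradient_stepsize \<gamma> f x \<alpha> \<theta>"
    and "\<theta> 0 i = 0" and ratio: "\<And>k. \<theta> (Suc k) i = \<alpha> (Suc k) i / \<alpha> k i"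
    and "x 1 i \<noteq> x 0 i" and "1 / (2 * \<gamma> * L) \<le> \<alpha> 0 i"
  shows "1 / (2 * \<gamma> * L) \<le> \<alpha> k i \<and> 0 \<le> \<theta> k i"
proof (induction k)
  case 0
  then show ?case using assms by simp
next
  case (Suc k)
  have pos: "0 < 1 / (2 * \<gamma> * L)" using assms by simp
  have "1 / (2 * \<gamma> * L) \<le> \<alpha> (Suc k) i"
  proof (cases "x (Suc k) i = x k i")
    case True
    \<comment> \<open>The update keeps the stepsize only from \<open>k = 1\<close> on; the first iterates are distinct.\<close>
    then have "k \<ge> 1" using \<open>x 1 i \<noteq> x 0 i\<close> by (cases k) auto
    then show ?thesis
      using True Suc step unfolding local_gradient_stepsize_def by simp
  next
    case False
    have "0 < local_L f x k i"
      using local_L_ge[of \<mu> f i x k] assms False by simp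
    then have "1 / (2 * \<gamma> * L) \<le> 1 / (2 * \<gamma> * local_L f x k i)"
      using local_L_le[of L f i x k] assms False by (simp add: frac_le)
    moreover have "\<alpha> k i \<le> sqrt (1 + \<theta> k i) * \<alpha> k i"
    proof -
      have "0 \<le> \<alpha> k i" using Suc pos by linarith
      then show ?thesis
        using mult_right_mono[of 1 "sqrt (1 + \<theta> k i)" "\<alpha> k i"] Suc by simp
    qed
    ultimately show ?thesis
      using False Suc step unfolding local_gradient_stepsize_def by simp
  qed
  moreover from this have "0 \<le> \<theta> (Suc k) i"
    using Suc pos unfolding ratio[of k] by (intro divide_nonneg_nonneg) linarith+
  ultimately show ?case by simp
qed

lemma stepsize_upper_bound:
  assumes "strongly_convex_with \<mu> (f i)" and "\<mu> > 0" and "\<gamma> > 0"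
    and step: "local_gradient_stepsize \<gamma> f x \<alpha> \<theta>"
    and "x 1 i \<noteq> x 0 i"
  shows "\<alpha> (Suc k) i \<le> 1 / (2 * \<gamma> * \<mu>)"
proof -
  have moved: "\<alpha> (Suc k) i \<le> 1 / (2 * \<gamma> * \<mu>)" if "x (Suc k) i \<noteq> x k i" for k
  proof -
    have "\<alpha> (Suc k) i \<le> 1 / (2 * \<gamma> * local_L f x k i)"
      using step that unfolding local_gradient_stepsize_def by simp
    also have "\<dots> \<le> 1 / (2 * \<gamma> * \<mu>)"
      using local_L_ge[of \<mu> f i x k] assms that by (simp add: frac_le)
    finally show ?thesis .
  qed
  show ?thesis
  proof (induction k)
    case 0
    then show ?case using moved[of 0] assms by simp
  next
    case (Suc k)
    then show ?case
      using moved[of "Suc k"] step unfolding local_gradient_stepsize_def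
      by (cases "x (Suc (Suc k)) i = x (Suc k) i") auto
  qed
qed

theorem lemma1:
  fixes E :: "('n::finite \<times> 'n) set"
    and W :: "real ^ 'n ^ 'n"
    and f :: "'n \<Rightarrow> real ^ 'p \<Rightarrow> real"
    and L \<mu> :: "'n \<Rightarrow> real"
    and \<gamma> :: real
    and x y :: "nat \<Rightarrow> 'n \<Rightarrow> real ^ 'p"
    and \<alpha> \<theta> :: "nat \<Rightarrow> 'n \<Rightarrow> real"
  assumes "undirected_connected E"
    and "mixing_matrix E W"
    and "\<And>i. smooth_with (L i) (f i)"
    and "\<And>i. \<mu> i > 0"
    and "\<And>i. strongly_convex_with (\<mu> i) (f i)"
    and "\<gamma> > 0"
    and "AdGT E W f x y \<alpha> \<theta>"
    and "local_gradient_stepsize \<gamma> f x \<alpha> \<theta>"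
    and "\<And>i. x 1 i \<noteq> x 0 i"
    and "\<And>i. \<alpha> 0 i \<ge> 1 / (2 * \<gamma> * L i)"
  shows "\<forall>i. \<forall>k\<ge>1. 1 / (2 * \<gamma> * Max (range L)) \<le> \<alpha> k i
                 \<and> \<alpha> k i \<le> 1 / (2 * \<gamma> * Min (range \<mu>))"
proof (intro allI impI conjI)
  fix i :: 'n and k :: nat
  assume "1 \<le> k"
  \<comment> \<open>The gradient quotient of the first step is at least \<open>\<mu> i\<close> and at most \<open>L i\<close>.\<close>
  have L_pos: "0 < L i" for i
    using local_L_ge[of "\<mu> i" f i x 0] local_L_le[of "L i" f i x 0] assms(3,4,5,9)[of i] by simp
  have "L i \<le> Max (range L)" by (simp add: Max_ge)
  then have "1 / (2 * \<gamma> * Max (range L)) \<le> 1 / (2 * \<gamma> * L i)"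
    using L_pos[of i] \<open>\<gamma> > 0\<close> by (simp add: frac_le)
  also have "\<dots> \<le> \<alpha> k i"
    using stepsize_lower_bound[of "L i" f i "\<mu> i" \<gamma> x \<alpha> \<theta> k] assms L_pos[of i]
    unfolding AdGT_def by blast
  finally show "1 / (2 * \<gamma> * Max (range L)) \<le> \<alpha> k i" .
  have "Min (range \<mu>) > 0" using assms(4) by (subst Min_gr_iff) auto
  moreover have "Min (range \<mu>) \<le> \<mu> i" by simp
  ultimately have "1 / (2 * \<gamma> * \<mu> i) \<le> 1 / (2 * \<gamma> * Min (range \<mu>))"
    using \<open>\<gamma> > 0\<close> by (simp add: frac_le)
  moreover have "\<alpha> k i \<le> 1 / (2 * \<gamma> * \<mu> i)"
    using stepsize_upper_bound[of "\<mu> i" f i \<gamma> x \<alpha> \<theta> "k - 1"] assms \<open>1 \<le> k\<close> by simp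
  ultimately show "\<alpha> k i \<le> 1 / (2 * \<gamma> * Min (range \<mu>))" by linarith
qed

end
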